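(* (i) The reduction $\to_{\beta\eta\pi}$ is Church–Rosser. (ii) For all $\lambda$-terms $M,N$: $\Theta MN =_{\beta\eta\pi}\Omega$ if and only if $\lambda\pi\vdash M=N$.
   Context: $\Omega \equiv (\lambda x.xx)(\lambda x.xx)$, $B \equiv \lambda x.x(\lambda y.yx)$, $C \equiv \lambda z.zB$, $\Theta \equiv BC$. $\lambda\pi$ is the least $\lambda$-theory (congruence on $\lambda$-terms containing $\alpha\beta$-conversion) containing $\eta$-conversion and the equation $\Theta xx = \Omega$. Let $\mathcal{G}_\beta(\Theta)$ be the set of terms to which $\Theta$ reduces in zero or more $\beta$-steps. The $\pi$-reduction is given by $\Psi MN \to_\pi \Omega$ whenever $\Psi\in\mathcal{G}_\beta(\Theta)$ and $\lambda\pi\vdash M=N$. The reduction $\to_{\beta\eta\pi}$ is the contextual closure of the union of $\beta$-, $\eta$- and $\pi$-reduction, and $=_{\beta\eta\pi}$ is its reflexive, symmetric, transitive closure. *)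

theory Defs
  imports Main "HOL-Library.Confluence"
begin

text \<open>
  Lambda-terms modulo alpha-conversion are represented by de Bruijn terms: \<open>Var i\<close> refers to the
  \<open>i\<close>-th enclosing \<open>Lam\<close>, and indices exceeding the number of enclosing binders are the free
  variables. Alpha-conversion is therefore equality.
\<close>

datatype lam =
    Var nat
  | App lam lam (infixl \<open>\<degree>\<close> 200)
  | Lam lam

primrec lift :: "lam \<Rightarrow> nat \<Rightarrow> lam" where
  "lift (Var i) k = (if i < k then Var i else Var (i + 1))"
| "lift (s \<degree> t) k = lift s k \<degree> lift t k"
| "lift (Lam s) k = Lam (lift s (k + 1))"

text \<open>
  \<open>subst t s k\<close> replaces index \<open>k\<close> by \<open>s\<close> and decrements the larger indices, since the binder of
  \<open>k\<close> disappears.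
\<close>

primrec subst :: "lam \<Rightarrow> lam \<Rightarrow> nat \<Rightarrow> lam" where
  "subst (Var i) s k = (if k < i then Var (i - 1) else if i = k then s else Var i)"
| "subst (t \<degree> u) s k = subst t s k \<degree> subst u s k"
| "subst (Lam t) s k = Lam (subst t (lift s 0) (k + 1))"

inductive ctxt_closure :: "(lam \<Rightarrow> lam \<Rightarrow> bool) \<Rightarrow> lam \<Rightarrow> lam \<Rightarrow> bool"
  for R :: "lam \<Rightarrow> lam \<Rightarrow> bool" where
  base: "R s t \<Longrightarrow> ctxt_closure R s t"
| appL: "ctxt_closure R s t \<Longrightarrow> ctxt_closure R (s \<degree> u) (t \<degree> u)"
| appR: "ctxt_closure R s t \<Longrightarrow> ctxt_closure R (u \<degree> s) (u \<degree> t)"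
| lam: "ctxt_closure R s t \<Longrightarrow> ctxt_closure R (Lam s) (Lam t)"

inductive beta_rule :: "lam \<Rightarrow> lam \<Rightarrow> bool" where
  "beta_rule (Lam s \<degree> t) (subst s t 0)"

text \<open>Lifting \<open>s\<close> expresses that the abstracted variable is not free in it.\<close>

inductive eta_rule :: "lam \<Rightarrow> lam \<Rightarrow> bool" where
  "eta_rule (Lam (lift s 0 \<degree> Var 0)) s"

definition beta :: "lam \<Rightarrow> lam \<Rightarrow> bool" where
  "beta = ctxt_closure beta_rule"

definition eta :: "lam \<Rightarrow> lam \<Rightarrow> bool" where
  "eta = ctxt_closure eta_rule"

definition Omega :: lam where
  "Omega = Lam (Var 0 \<degree> Var 0) \<degree> Lam (Var 0 \<degree> Var 0)"

definition B_term :: lam where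
  "B_term = Lam (Var 0 \<degree> Lam (Var 0 \<degree> Var 1))"

definition C_term :: lam where
  "C_term = Lam (Var 0 \<degree> B_term)"

definition Theta :: lam where
  "Theta = B_term \<degree> C_term"

definition lambda_theory :: "(lam \<Rightarrow> lam \<Rightarrow> bool) \<Rightarrow> bool" where
  "lambda_theory T \<longleftrightarrow>
     equivp T \<and>
     (\<forall>M M' N N'. T M M' \<longrightarrow> T N N' \<longrightarrow> T (M \<degree> N) (M' \<degree> N')) \<and>
     (\<forall>M N. T M N \<longrightarrow> T (Lam M) (Lam N)) \<and>
     equivclp beta \<le> T"

definition pi_theory :: "(lam \<Rightarrow> lam \<Rightarrow> bool) \<Rightarrow> bool" where
  "pi_theory T \<longleftrightarrow>
     lambda_theory T \<and> equivclp eta \<le> T \<and> (\<forall>i. T (Theta \<degree> Var i \<degree> Var i) Omega)"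

definition lambda_pi :: "lam \<Rightarrow> lam \<Rightarrow> bool" where
  "lambda_pi M N \<longleftrightarrow> (\<forall>T. pi_theory T \<longrightarrow> T M N)"

lemma pi_theory_lambda_pi: "pi_theory lambda_pi"
  unfolding pi_theory_def [of lambda_pi] lambda_theory_def [of lambda_pi]
proof (intro conjI)
  have eq: "equivp T" if "pi_theory T" for T
    using that by (simp add: pi_theory_def lambda_theory_def)
  show "equivp lambda_pi"
  proof (rule equivpI)
    show "reflp lambda_pi"
      by (intro reflpI) (auto simp: lambda_pi_def intro: equivp_reflp [OF eq])
    show "symp lambda_pi"
      by (intro sympI) (metis lambda_pi_def eq equivp_symp)
    show "transp lambda_pi"
      by (intro transpI) (metis lambda_pi_def eq equivp_transp)
  qed
  have "T (M \<degree> N) (M' \<degree> N')" if "pi_theory T" "T M M'" "T N N'" for T M M' N N'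
    using that by (simp add: pi_theory_def lambda_theory_def)
  then show "\<forall>M M' N N'. lambda_pi M M' \<longrightarrow> lambda_pi N N' \<longrightarrow> lambda_pi (M \<degree> N) (M' \<degree> N')"
    by (metis lambda_pi_def)
  have "T (Lam M) (Lam N)" if "pi_theory T" "T M N" for T M N
    using that by (simp add: pi_theory_def lambda_theory_def)
  then show "\<forall>M N. lambda_pi M N \<longrightarrow> lambda_pi (Lam M) (Lam N)"
    by (metis lambda_pi_def)
qed (auto simp: lambda_pi_def pi_theory_def lambda_theory_def le_fun_def)

lemma lambda_pi_least: "pi_theory T \<Longrightarrow> lambda_pi \<le> T"
  unfolding le_fun_def le_bool_def lambda_pi_def by metis

definition G_beta :: "lam \<Rightarrow> lam set" where
  "G_beta M = {P. beta\<^sup>*\<^sup>* M P}"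

inductive pi_rule :: "lam \<Rightarrow> lam \<Rightarrow> bool" where
  "\<Psi> \<in> G_beta Theta \<Longrightarrow> lambda_pi M N \<Longrightarrow> pi_rule (\<Psi> \<degree> M \<degree> N) Omega"

definition beta_eta_pi :: "lam \<Rightarrow> lam \<Rightarrow> bool" where
  "beta_eta_pi = ctxt_closure (sup beta_rule (sup eta_rule pi_rule))"

end

theory Submission
  imports Defs
begin

text \<open>
  Three closed terms make up \<open>G_beta Theta\<close>; they form a reduction cycle and contain no other redex.
  As \<^const>\<open>lambda_pi\<close> is stable under substitution and contains the reduction, \<open>\<pi>\<close>-redexes stay
  \<open>\<pi>\<close>-redexes under substitution and reduction, and the diamond property of a parallel reduction
  gives confluence, with one dangerous overlap: \<open>\<lambda>x. \<Psi> M x\<close>, with \<open>x\<close> not free in \<open>M\<close>, \<open>\<eta>\<close>-reduces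
  to \<open>\<Psi> M\<close> and, if \<open>\<lambda>\<pi>\<close> proves \<open>M = x\<close>, also \<open>\<pi>\<close>-reduces to \<open>\<lambda>x. \<Omega>\<close>. This cannot happen since \<open>\<lambda>\<pi>\<close>
  is consistent: it is contained in the conversion of another reduction, which contracts to \<open>\<Omega>\<close> every
  term obtained from \<open>\<Omega>\<close> or an element of \<open>G_beta Theta\<close> by applying to arguments and abstracting.
  The same diamond argument shows that this reduction is confluent, and distinct variables are distinct
  normal forms of it. Both reductions are treated at once by contracting an arbitrary set \<open>P\<close> of
  terms to \<open>\<Omega>\<close>.
\<close>

section \<open>De Bruijn lifting and substitution\<close>

lemma lift_lift: "i \<le> k \<Longrightarrow> lift (lift t i) (Suc k) = lift (lift t k) i"
  by (induct t arbitrary: i k) auto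

lemma lift_subst: "j \<le> i \<Longrightarrow> lift (subst t s j) i = subst (lift t (Suc i)) (lift s i) j"
  by (induct t arbitrary: i j s) (auto simp: lift_lift)

lemma lift_subst_ge: "i \<le> j \<Longrightarrow> lift (subst t s j) i = subst (lift t i) (lift s i) (Suc j)"
  by (induct t arbitrary: i j s) (auto simp: lift_lift)

lemma subst_lift [simp]: "subst (lift t k) s k = t"
  by (induct t arbitrary: k s) auto

lemma subst_lift_Var [simp]: "subst (lift t (Suc k)) (Var k) k = t"
  by (induct t arbitrary: k) auto

text \<open>The substitution lemma; \<open>v\<close> is lifted and \<open>j\<close> is shifted
  because \<open>t\<close> still contains index \<open>i\<close>.\<close>

lemma subst_subst:
  "i \<le> j \<Longrightarrow> subst (subst t (lift v i) (Suc j)) (subst u v j) i = subst (subst t u i) v j"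
proof (induct t arbitrary: i j u v)
  case (Lam t)
  then show ?case
    by (simp add: lift_lift [symmetric] lift_subst_ge)
qed auto

lemma size_lift [simp]: "size (lift t k) = size t"
  by (induct t arbitrary: k) auto

lemma lift_inject [simp]: "lift s k = lift t k \<longleftrightarrow> s = t"
  by (metis subst_lift)

lemma lift_eq_App: "lift s k = t \<degree> u \<longleftrightarrow> (\<exists>a b. s = a \<degree> b \<and> t = lift a k \<and> u = lift b k)"
  by (cases s) auto

lemma lift_eq_Lam: "lift s k = Lam t \<longleftrightarrow> (\<exists>a. s = Lam a \<and> t = lift a (Suc k))"
  by (cases s) auto

lemma lift_eq_Var_less: "i < k \<Longrightarrow> lift s k = Var i \<longleftrightarrow> s = Var i"
  by (cases s) auto

lemma lift_neq_Var [simp]: "lift s k \<noteq> Var k" "Var k \<noteq> lift s k"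
  by (cases s; auto)+

text \<open>A term that avoids two indices arises by two liftings from one term. This separates the
  variable of an eta-redex from another absent variable.\<close>

lemma lift_eq_lift_Suc:
  assumes "lift a i = lift b (Suc k)" "i \<le> k"
  obtains c where "a = lift c k" "b = lift c i"
proof -
  \<comment> \<open>Index \<open>Suc k\<close> is absent, so any term may be substituted for it;
    choosing a lifted one makes the lifting at \<open>i\<close> move outwards.\<close>
  have "b = subst (lift a i) (lift (Var 0) i) (Suc k)"
    by (simp add: assms)
  also have "\<dots> = lift (subst a (Var 0) k) i"
    using assms by (simp only: lift_subst_ge)
  finally have "b = lift (subst a (Var 0) k) i" .
  with that assms show thesis
    by (metis lift_inject lift_lift)
qed

lemma lift_Omega [simp]: "lift Omega k = Omega"
  and subst_Omega [simp]: "subst Omega s k = Omega"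
  by (simp_all add: Omega_def)

section \<open>Reduction with contraction of a set of terms to \<open>Omega\<close>\<close>

definition step :: "lam set \<Rightarrow> lam \<Rightarrow> lam \<Rightarrow> bool" where
  "step P = ctxt_closure (sup beta_rule (sup eta_rule (\<lambda>s t. s \<in> P \<and> t = Omega)))"

lemma step_Var_iff: "step P (Var i) t \<longleftrightarrow> Var i \<in> P \<and> t = Omega"
  unfolding step_def
  by (subst ctxt_closure.simps) (auto simp: beta_rule.simps eta_rule.simps)

lemma step_App_iff:
  "step P (s \<degree> t) u \<longleftrightarrow>
     (\<exists>a. s = Lam a \<and> u = subst a t 0) \<or> s \<degree> t \<in> P \<and> u = Omega \<or>
     (\<exists>s'. step P s s' \<and> u = s' \<degree> t) \<or> (\<exists>t'. step P t t' \<and> u = s \<degree> t')"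
  unfolding step_def
  by (subst ctxt_closure.simps) (auto simp: beta_rule.simps eta_rule.simps)

lemma step_Lam_iff:
  "step P (Lam s) u \<longleftrightarrow>
     s = lift u 0 \<degree> Var 0 \<or> Lam s \<in> P \<and> u = Omega \<or> (\<exists>s'. step P s s' \<and> u = Lam s')"
  unfolding step_def
  by (subst ctxt_closure.simps) (auto simp: beta_rule.simps eta_rule.simps)

text \<open>Inversion in the form of equivalences lets the simplifier enumerate the reducts of a
  concrete term.\<close>

lemmas step_iff = step_Var_iff step_App_iff step_Lam_iff

lemma step_Omega_rule: "s \<in> P \<Longrightarrow> step P s Omega"
  unfolding step_def by (auto intro: ctxt_closure.base)

lemma steps_App:
  assumes "(step P)\<^sup>*\<^sup>* s s'" "(step P)\<^sup>*\<^sup>* t t'"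
  shows "(step P)\<^sup>*\<^sup>* (s \<degree> t) (s' \<degree> t')"
proof -
  have "(step P)\<^sup>*\<^sup>* (s \<degree> t) (s' \<degree> t)"
    using assms(1) by induct (auto simp: step_App_iff intro: rtranclp.rtrancl_into_rtrancl)
  also have "(step P)\<^sup>*\<^sup>* (s' \<degree> t) (s' \<degree> t')"
    using assms(2) by induct (auto simp: step_App_iff intro: rtranclp.rtrancl_into_rtrancl)
  finally show ?thesis .
qed

lemma steps_Lam: "(step P)\<^sup>*\<^sup>* s s' \<Longrightarrow> (step P)\<^sup>*\<^sup>* (Lam s) (Lam s')"
  by (induct rule: rtranclp_induct) (auto simp: step_Lam_iff intro: rtranclp.rtrancl_into_rtrancl)

text \<open>
  The last four conditions resolve the overlaps of \<open>P\<close>-contraction with an enclosing \<open>\<beta>\<close>- or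
  \<open>\<eta>\<close>-redex; for \<open>\<pi>\<close>-reduction they hold vacuously.
\<close>

locale Omega_rule =
  fixes P :: "lam set"
  assumes lift_P: "s \<in> P \<Longrightarrow> lift s k \<in> P"
    and unlift_P: "lift s k \<in> P \<Longrightarrow> s \<in> P"
    and subst_P: "s \<in> P \<Longrightarrow> subst s t k \<in> P"
    and step_P: "s \<in> P \<Longrightarrow> step P s t \<Longrightarrow> t \<in> P"
    and Var_P: "Var i \<notin> P"
    and Lam_P: "Lam s \<in> P \<Longrightarrow> s \<in> P"
    and Lam_P_Omega: "Lam s \<in> P \<Longrightarrow> Omega \<degree> t \<in> P"
    and eta_P: "lift s 0 \<degree> Var 0 \<in> P \<Longrightarrow> s \<in> P"
    and eta_P_Omega: "lift s 0 \<degree> Var 0 \<in> P \<Longrightarrow> Lam Omega \<in> P"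
begin

section \<open>Parallel reduction and its diamond property\<close>

text \<open>Rule \<open>omega\<close> does not reduce inside \<open>s\<close> first:
  \<open>P\<close> is closed under reduction, so every reduct of \<open>s\<close> still contracts to
  \<open>Omega\<close>.\<close>

inductive par :: "lam \<Rightarrow> lam \<Rightarrow> bool" (infix \<open>\<rightrightarrows>\<close> 50) where
  var: "Var i \<rightrightarrows> Var i"
| app: "s \<rightrightarrows> s' \<Longrightarrow> t \<rightrightarrows> t' \<Longrightarrow> s \<degree> t \<rightrightarrows> s' \<degree> t'"
| lam: "s \<rightrightarrows> s' \<Longrightarrow> Lam s \<rightrightarrows> Lam s'"
| beta: "s \<rightrightarrows> s' \<Longrightarrow> t \<rightrightarrows> t' \<Longrightarrow> Lam s \<degree> t \<rightrightarrows> subst s' t' 0"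
| eta: "s \<rightrightarrows> s' \<Longrightarrow> Lam (lift s 0 \<degree> Var 0) \<rightrightarrows> s'"
| omega: "s \<in> P \<Longrightarrow> s \<rightrightarrows> Omega"

lemma par_refl [simp]: "s \<rightrightarrows> s"
  by (induct s) (auto intro: par.intros)

lemma step_imp_par:
  assumes "step P s t"
  shows "s \<rightrightarrows> t"
  using assms unfolding step_def
  by (induct rule: ctxt_closure.induct) (auto simp: beta_rule.simps eta_rule.simps intro: par.intros)

lemma par_imp_steps:
  assumes "s \<rightrightarrows> t"
  shows "(step P)\<^sup>*\<^sup>* s t"
  using assms
proof (induct rule: par.induct)
  case (beta s s' t t')
  then have "(step P)\<^sup>*\<^sup>* (Lam s \<degree> t) (Lam s' \<degree> t')"
    by (intro steps_App steps_Lam)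
  then show ?case
    by (rule rtranclp.rtrancl_into_rtrancl) (simp add: step_App_iff)
next
  case (eta s s')
  have "step P (Lam (lift s 0 \<degree> Var 0)) s"
    by (simp add: step_Lam_iff)
  with eta show ?case
    by (simp add: converse_rtranclp_into_rtranclp)
qed (auto intro: steps_App steps_Lam step_Omega_rule)

lemma par_P:
  assumes "s \<rightrightarrows> t" "s \<in> P"
  shows "t \<in> P"
  using par_imp_steps [OF assms(1)] assms(2) by induct (auto intro: step_P)

lemma par_lift: "s \<rightrightarrows> t \<Longrightarrow> lift s k \<rightrightarrows> lift t k"
proof (induct arbitrary: k rule: par.induct)
  case (eta s s')
  then have "Lam (lift (lift s k) 0 \<degree> Var 0) \<rightrightarrows> lift s' k"
    by (intro par.eta)
  then show ?case
    by (simp add: lift_lift)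
qed (auto simp: lift_subst intro: par.intros lift_P)

lemma par_subst:
  assumes "s \<rightrightarrows> s'" "t \<rightrightarrows> t'"
  shows "subst s t k \<rightrightarrows> subst s' t' k"
  using assms
proof (induct arbitrary: t t' k rule: par.induct)
  case (beta a a' b b')
  then have "Lam (subst a (lift t 0) (Suc k)) \<degree> subst b t k
      \<rightrightarrows> subst (subst a' (lift t' 0) (Suc k)) (subst b' t' k) 0"
    by (intro par.beta) (auto intro: par_lift)
  then show ?case
    by (simp add: subst_subst)
next
  case (eta a a')
  then have "Lam (lift (subst a t k) 0 \<degree> Var 0) \<rightrightarrows> subst a' t' k"
    by (intro par.eta) auto
  then show ?case
    by (simp add: lift_subst_ge)
next
  case (lam a a')
  then show ?case
    by (simp add: par.lam par_lift)
qed (auto intro: par.intros par_lift subst_P)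

lemma par_VarE:
  assumes "Var i \<rightrightarrows> u"
  obtains "u = Var i"
  using assms Var_P by cases auto

lemma par_AppE:
  assumes "s \<degree> t \<rightrightarrows> u"
  obtains (app) s' t' where "u = s' \<degree> t'" "s \<rightrightarrows> s'" "t \<rightrightarrows> t'"
    | (beta) a a' t' where "s = Lam a" "u = subst a' t' 0" "a \<rightrightarrows> a'" "t \<rightrightarrows> t'"
    | (omega) "u = Omega" "s \<degree> t \<in> P"
  using assms by cases auto

lemma par_LamE:
  assumes "Lam s \<rightrightarrows> u"
  obtains (lam) s' where "u = Lam s'" "s \<rightrightarrows> s'"
    | (eta) a where "s = lift a 0 \<degree> Var 0" "a \<rightrightarrows> u"
    | (omega) "u = Omega" "Lam s \<in> P"
  using assms by cases auto

text \<open>Reduction creates no free variables. Hence reducing the function part of an eta-redex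
  leaves an eta-redex.\<close>

lemma par_lift_inverse:
  assumes "lift s k \<rightrightarrows> t"
  shows "\<exists>s'. t = lift s' k \<and> s \<rightrightarrows> s'"
  using assms
proof (induct "lift s k" t arbitrary: s k rule: par.induct)
  case (var i)
  then show ?case
    by (metis par_refl)
next
  case (app a a' b b')
  then obtain a0 b0 where ab: "s = a0 \<degree> b0" "a = lift a0 k" "b = lift b0 k"
    by (metis lift_eq_App)
  with app obtain a1 b1 where "a' = lift a1 k" "a0 \<rightrightarrows> a1" "b' = lift b1 k" "b0 \<rightrightarrows> b1"
    by metis
  with ab show ?case
    by (metis lift.simps(2) par.app)
next
  case (lam a a')
  then obtain a0 where a: "s = Lam a0" "a = lift a0 (Suc k)"
    by (metis lift_eq_Lam)
  with lam obtain a1 where "a' = lift a1 (Suc k)" "a0 \<rightrightarrows> a1"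
    by metis
  with a show ?case
    by (metis Suc_eq_plus1 lift.simps(3) par.lam)
next
  case (beta a a' b b')
  then obtain a0 b0 where ab: "s = Lam a0 \<degree> b0" "a = lift a0 (Suc k)" "b = lift b0 k"
    by (metis lift_eq_App lift_eq_Lam)
  with beta obtain a1 b1 where "a' = lift a1 (Suc k)" "a0 \<rightrightarrows> a1" "b' = lift b1 k" "b0 \<rightrightarrows> b1"
    by metis
  with ab show ?case
    by (intro exI [of _ "subst a1 b1 0"]) (simp add: lift_subst par.beta)
next
  case (eta a a')
  have "lift s k = Lam (lift a 0 \<degree> Var 0)"
    using eta by simp
  then obtain d where "s = Lam d" "lift d (Suc k) = lift a 0 \<degree> Var 0"
    unfolding lift_eq_Lam by fastforce
  then obtain b x where "s = Lam (b \<degree> x)" "lift a 0 = lift b (Suc k)" "lift x (Suc k) = Var 0"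
    unfolding lift_eq_App by fastforce
  then have s: "s = Lam (b \<degree> Var 0)" "lift a 0 = lift b (Suc k)"
    by (simp_all add: lift_eq_Var_less)
  \<comment> \<open>The function part avoids both the eta-variable and index \<open>k\<close>;
    \<open>c\<close> is that part with both removed.\<close>
  from s(2) obtain c where c: "a = lift c k" "b = lift c 0"
    by (rule lift_eq_lift_Suc) simp
  from eta.hyps(2) [OF c(1)] obtain c' where "a' = lift c' k" "c \<rightrightarrows> c'"
    by blast
  with s c show ?case
    by (auto intro: par.eta)
next
  case (omega s')
  then show ?case
    by (metis lift_Omega par.omega unlift_P)
qed

text \<open>In case \<open>beta\<close> the argument is the variable itself, so contraction merely
  renames the bound variable of \<open>b\<close> and yields a reduct of its body
  \<open>c\<close>.\<close>

lemma par_eta_body: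
  assumes "lift b 0 \<degree> Var 0 \<rightrightarrows> w"
  obtains (app) b' where "b \<rightrightarrows> b'" "w = lift b' 0 \<degree> Var 0"
    | (beta) c where "b = Lam c" "c \<rightrightarrows> w"
    | (omega) "lift b 0 \<degree> Var 0 \<in> P" "w = Omega"
  using assms
proof (cases rule: par_AppE)
  case (app s' t')
  then show ?thesis
    by (metis Var_P par_VarE par_lift_inverse that(1))
next
  case (beta a a' t')
  then obtain c where c: "b = Lam c" "a = lift c (Suc 0)"
    by (metis lift_eq_Lam)
  with beta obtain c' where "a' = lift c' (Suc 0)" "c \<rightrightarrows> c'"
    by (metis par_lift_inverse)
  moreover have "t' = Var 0"
    using beta Var_P by (metis par_VarE)
  ultimately show ?thesis
    using c beta that(2) by simp
qed (use that in auto)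

text \<open>The induction is on size because one overlap of beta and eta needs the claim for a
  smaller term that is not a subterm.\<close>

lemma par_diamond: "s \<rightrightarrows> t \<Longrightarrow> s \<rightrightarrows> u \<Longrightarrow> \<exists>v. t \<rightrightarrows> v \<and> u \<rightrightarrows> v"
proof (induct s arbitrary: t u rule: measure_induct_rule [of size])
  case (less s)
  \<comment> \<open>Elements of \<open>P\<close> join at \<open>Omega\<close>. This settles every
    \<open>s\<close> in \<open>P\<close>, so afterwards no contraction to \<open>Omega\<close>
    occurs at the root.\<close>
  have P: "\<exists>v. t \<rightrightarrows> v \<and> u \<rightrightarrows> v" if "t \<in> P" "u \<in> P" for t u
    using that par.omega by blast
  show ?case
  proof (cases "s \<in> P")
    case True
    with less.prems show ?thesis
      by (blast intro: P par_P)
  next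
    case False
    show ?thesis
    proof (cases s)
      case (Var i)
      with False less.prems show ?thesis
        by (metis par_VarE)
    next
      case (Lam a)
      \<comment> \<open>Overlap of an eta-contraction at the root with a reduction of the
        body.\<close>
      have lam_eta: "\<exists>v. Lam a' \<rightrightarrows> v \<and> b' \<rightrightarrows> v"
        if "a \<rightrightarrows> a'" and a: "a = lift b 0 \<degree> Var 0" and b': "b \<rightrightarrows> b'" for a' b b'
      proof -
        have size: "size b < size s"
          by (simp add: Lam a)
        have "lift b 0 \<degree> Var 0 \<rightrightarrows> a'"
          using that by simp
        then show ?thesis
        proof (cases rule: par_eta_body)
          case (app b'')
          then show ?thesis
            using less.hyps [OF size b'] par.eta by metis
        next
          case (beta c)
          then show ?thesis
            using less.hyps [OF size b'] par.lam by metis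
        next
          \<comment> \<open>Here \<open>a'\<close> is \<open>Omega\<close>; both
            \<open>Lam Omega\<close> and \<open>b'\<close> lie in \<open>P\<close>.\<close>
          case omega
          then show ?thesis
            using P b' eta_P eta_P_Omega par_P by blast
        qed
      qed
      from less.prems(1) [unfolded Lam] show ?thesis
      proof (cases rule: par_LamE)
        case t: (lam a')
        from less.prems(2) [unfolded Lam] show ?thesis
        proof (cases rule: par_LamE)
          case (lam a'')
          then show ?thesis
            using t less.hyps [of a a' a''] by (auto simp: Lam intro: par.lam)
        next
          case (eta b)
          then show ?thesis
            using t lam_eta by auto
        qed (use False Lam in auto)
      next
        case t: (eta b)
        from less.prems(2) [unfolded Lam] show ?thesis
        proof (cases rule: par_LamE)
          case (lam a'')
          then show ?thesis
            using t lam_eta by blast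
        next
          case (eta b')
          then show ?thesis
            using t less.hyps [of b t u] by (auto simp: Lam)
        qed (use False Lam in auto)
      qed (use False Lam in auto)
    next
      case (App a b)
      \<comment> \<open>Overlap of a beta-contraction at the root with a reduction of the operator,
        which may destroy the abstraction by eta or by contraction to \<open>Omega\<close>.\<close>
      have app_beta: "\<exists>v. f \<degree> b'' \<rightrightarrows> v \<and> subst c' b' 0 \<rightrightarrows> v"
        if a: "a = Lam c" and f: "a \<rightrightarrows> f" and c: "c \<rightrightarrows> c'" and b: "b \<rightrightarrows> b'" "b \<rightrightarrows> b''"
        for c c' f b' b''
      proof -
        obtain d where d: "b' \<rightrightarrows> d" "b'' \<rightrightarrows> d"
          using less.hyps [of b b' b''] b by (auto simp: App)
        from f [unfolded a] show ?thesis
        proof (cases rule: par_LamE)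
          case (lam c'')
          then obtain e where "c' \<rightrightarrows> e" "c'' \<rightrightarrows> e"
            using less.hyps [of c c' c''] c by (auto simp: App a)
          with lam d show ?thesis
            by (metis par.beta par_subst)
        next
          case (eta x)
          from c [unfolded eta] show ?thesis
          proof (cases rule: par_eta_body)
            case (app x')
            then obtain e where "x' \<rightrightarrows> e" "f \<rightrightarrows> e"
              using less.hyps [of x x' f] eta by (auto simp: App a)
            with app d show ?thesis
              by (auto intro: par.app)
          next
            \<comment> \<open>Now \<open>x\<close> is \<open>Lam y\<close>. Contracting the
              eta-redex in the operator of \<open>s\<close> gives the smaller term
              \<open>x \<degree> b\<close>, of which both sides are parallel reducts.\<close>
            case (beta y)
            then have "x \<degree> b \<rightrightarrows> subst c' b' 0" "x \<degree> b \<rightrightarrows> f \<degree> b''"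
              using b eta by (auto intro: par.intros)
            moreover have "size (x \<degree> b) < size s"
              by (simp add: App a eta)
            ultimately show ?thesis
              using less.hyps by blast
          next
            \<comment> \<open>Here \<open>c'\<close> is \<open>Omega\<close>, which substitution
              leaves fixed; substituting \<open>b''\<close> for the eta-variable shows that the
              other side lies in \<open>P\<close>.\<close>
            case omega
            then have "lift f 0 \<degree> Var 0 \<in> P"
              using eta by (meson par.app par.var par_P par_lift)
            then have "f \<degree> b'' \<in> P"
              by (drule_tac subst_P [where t = b'' and k = 0]) simp
            with omega show ?thesis
              by (auto intro: par.omega)
          qed
        next
          \<comment> \<open>The operator has become \<open>Omega\<close>; the body stays in
            \<open>P\<close>, also after substitution, so both sides lie in
            \<open>P\<close>.\<close>
          case omega
          then have "subst c' b' 0 \<in> P"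
            using c Lam_P par.lam par_P subst_P by blast
          with omega show ?thesis
            using Lam_P_Omega P by blast
        qed
      qed
      from less.prems(1) [unfolded App] show ?thesis
      proof (cases rule: par_AppE)
        case t: (app a' b')
        from less.prems(2) [unfolded App] show ?thesis
        proof (cases rule: par_AppE)
          case (app a'' b'')
          then obtain e d where "a' \<rightrightarrows> e" "a'' \<rightrightarrows> e" "b' \<rightrightarrows> d" "b'' \<rightrightarrows> d"
            using t less.hyps [of a a' a''] less.hyps [of b b' b''] by (auto simp: App)
          with t app show ?thesis
            by (auto intro: par.app)
        next
          case (beta c c' b'')
          with t app_beta show ?thesis
            by blast
        qed (use False App in auto)
      next
        case t: (beta c c' b')
        from less.prems(2) [unfolded App] show ?thesis
        proof (cases rule: par_AppE)
          case (app a'' b'')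
          with t app_beta show ?thesis
            by blast
        next
          case (beta c2 c'' b'')
          then obtain e d where "c' \<rightrightarrows> e" "c'' \<rightrightarrows> e" "b' \<rightrightarrows> d" "b'' \<rightrightarrows> d"
            using t less.hyps [of c c' c''] less.hyps [of b b' b''] by (auto simp: App)
          with t beta show ?thesis
            by (auto intro: par_subst)
        qed (use False App in auto)
      qed (use False App in auto)
    qed
  qed
qed

lemma confluentp_step: "confluentp (step P)"
proof -
  have "par\<^sup>*\<^sup>* = (step P)\<^sup>*\<^sup>*"
    by (rule rtranclp_subset) (auto intro: step_imp_par par_imp_steps)
  moreover have "strong_confluentp par"
    by (rule strong_confluentpI) (use par_diamond in blast)
  then have "confluentp par"
    by (rule strong_confluentp_imp_confluentp)
  ultimately show ?thesis
    by (simp add: confluentp_conv_strong_confluentp_rtranclp)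
qed

end

section \<open>Conversion and the theory \<open>lambda_pi\<close>\<close>

lemma confluentp_equivclpE:
  assumes "confluentp r" "equivclp r x y"
  obtains u where "r\<^sup>*\<^sup>* x u" "r\<^sup>*\<^sup>* y u"
proof -
  have "(r\<^sup>*\<^sup>* OO r\<inverse>\<inverse>\<^sup>*\<^sup>*) x y"
    using assms by (simp only: semiconfluentp_equivclp confluentp_eq_semiconfluentp)
  then show thesis
    by (auto simp: rtranclp_conversep intro: that)
qed

lemma equivclp_least:
  assumes "equivp T" "\<And>x y. R x y \<Longrightarrow> T x y"
  shows "equivclp R \<le> T"
proof (rule predicate2I)
  fix x y
  assume "equivclp R x y"
  then show "T x y"
    by (induct rule: equivclp_induct)
      (use assms in \<open>blast intro: equivp_reflp equivp_symp equivp_transp\<close>)+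
qed

text \<open>Congruence propagates root beta- and eta-steps through contexts, so only these need
  checking.\<close>

lemma pi_theoryI:
  assumes "equivp T"
    and App: "\<And>M M' N N'. T M M' \<Longrightarrow> T N N' \<Longrightarrow> T (M \<degree> N) (M' \<degree> N')"
    and Lam: "\<And>M N. T M N \<Longrightarrow> T (Lam M) (Lam N)"
    and beta: "\<And>s t. T (Lam s \<degree> t) (subst s t 0)"
    and eta: "\<And>s. T (Lam (lift s 0 \<degree> Var 0)) s"
    and "\<And>i. T (Theta \<degree> Var i \<degree> Var i) Omega"
  shows "pi_theory T"
proof -
  have closure: "T s t" if "ctxt_closure R s t" "\<And>s t. R s t \<Longrightarrow> T s t" for R s t
    using that by induct (auto intro: App Lam equivp_reflp [OF assms(1)])
  have "equivclp beta \<le> T"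
    by (rule equivclp_least [OF assms(1)])
      (auto simp: beta_def beta_rule.simps intro: beta elim!: closure)
  moreover have "equivclp eta \<le> T"
    by (rule equivclp_least [OF assms(1)])
      (auto simp: eta_def eta_rule.simps intro: eta elim!: closure)
  ultimately show ?thesis
    using assms by (simp add: pi_theory_def lambda_theory_def)
qed

text \<open>By leastness of \<open>lambda_pi\<close>, this bounds it by the conversion of a
  confluent reduction.\<close>

lemma pi_theory_equivclp_step:
  assumes "\<And>i. Theta \<degree> Var i \<degree> Var i \<in> P"
  shows "pi_theory (equivclp (step P))"
proof (rule pi_theoryI)
  fix M M' N N'
  assume M: "equivclp (step P) M M'" and N: "equivclp (step P) N N'"
  from M have "equivclp (step P) (M \<degree> N) (M' \<degree> N)"
    by (induct rule: equivclp_induct) (auto simp: step_App_iff intro: equivclp_into_equivclp)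
  also from N have "equivclp (step P) (M' \<degree> N) (M' \<degree> N')"
    by (induct rule: equivclp_induct) (auto simp: step_App_iff intro: equivclp_into_equivclp)
  finally show "equivclp (step P) (M \<degree> N) (M' \<degree> N')" .
next
  fix M N
  assume "equivclp (step P) M N"
  then show "equivclp (step P) (Lam M) (Lam N)"
    by (induct rule: equivclp_induct) (auto simp: step_Lam_iff intro: equivclp_into_equivclp)
qed (use assms in \<open>auto simp: step_iff equivp_evquivclp intro!: r_into_equivclp step_Omega_rule\<close>)

lemma lambda_pi_equivp: "equivp lambda_pi"
  and lambda_pi_App: "lambda_pi M M' \<Longrightarrow> lambda_pi N N' \<Longrightarrow> lambda_pi (M \<degree> N) (M' \<degree> N')"
  and lambda_pi_Lam: "lambda_pi M N \<Longrightarrow> lambda_pi (Lam M) (Lam N)"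
  and equivclp_beta_lambda_pi: "equivclp beta \<le> lambda_pi"
  and equivclp_eta_lambda_pi: "equivclp eta \<le> lambda_pi"
  and lambda_pi_Theta_Var: "lambda_pi (Theta \<degree> Var i \<degree> Var i) Omega"
  using pi_theory_lambda_pi by (simp_all add: pi_theory_def lambda_theory_def)

lemmas lambda_pi_refl [simp] = equivp_reflp [OF lambda_pi_equivp]
  and lambda_pi_sym = equivp_symp [OF lambda_pi_equivp]
  and lambda_pi_trans [trans] = equivp_transp [OF lambda_pi_equivp]

lemma lambda_pi_beta: "lambda_pi (Lam s \<degree> t) (subst s t 0)"
  by (rule predicate2D [OF equivclp_beta_lambda_pi])
    (simp add: beta_def r_into_equivclp ctxt_closure.base beta_rule.intros)

lemma lambda_pi_eta: "lambda_pi (Lam (lift s 0 \<degree> Var 0)) s"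
  by (rule predicate2D [OF equivclp_eta_lambda_pi])
    (simp add: eta_def r_into_equivclp ctxt_closure.base eta_rule.intros)

lemma lift_Theta [simp]: "lift Theta k = Theta"
  and subst_Theta [simp]: "subst Theta s k = Theta"
  by (simp_all add: Theta_def B_term_def C_term_def)

text \<open>The axiom speaks of variables only. Abstracting the variable and applying to
  \<open>M\<close> gives every instance, as \<open>Theta\<close> and \<open>Omega\<close> are
  closed.\<close>

lemma lambda_pi_Theta: "lambda_pi (Theta \<degree> M \<degree> M) Omega"
proof -
  have "lambda_pi (Theta \<degree> M \<degree> M) (Lam (Theta \<degree> Var 0 \<degree> Var 0) \<degree> M)"
    using lambda_pi_beta [of "Theta \<degree> Var 0 \<degree> Var 0" M] by (simp add: lambda_pi_sym)
  also have "lambda_pi (Lam (Theta \<degree> Var 0 \<degree> Var 0) \<degree> M) (Lam Omega \<degree> M)"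
    by (intro lambda_pi_App lambda_pi_Lam lambda_pi_Theta_Var lambda_pi_refl)
  also have "lambda_pi (Lam Omega \<degree> M) Omega"
    using lambda_pi_beta [of Omega M] by simp
  finally show ?thesis .
qed

text \<open>The pairs that all substitutions send into \<open>lambda_pi\<close> form a pi-theory, so
  leastness applies.\<close>

lemma lambda_pi_subst:
  assumes "lambda_pi M N"
  shows "lambda_pi (subst M u k) (subst N u k)"
proof -
  \<comment> \<open>Both \<open>u\<close> and \<open>k\<close> are quantified since both change
    under a binder.\<close>
  let ?T = "\<lambda>M N. \<forall>u k. lambda_pi (subst M u k) (subst N u k)"
  have "pi_theory ?T"
  proof (rule pi_theoryI)
    show "equivp ?T"
      by (intro equivpI reflpI sympI transpI)
        (simp, blast intro: lambda_pi_sym, blast intro: lambda_pi_trans)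
    show "?T (Lam s \<degree> t) (subst s t 0)" for s t
      using lambda_pi_beta by (simp flip: subst_subst)
    show "?T (Lam (lift s 0 \<degree> Var 0)) s" for s
      using lambda_pi_eta by (simp flip: lift_subst_ge)
  qed (auto intro: lambda_pi_App lambda_pi_Lam lambda_pi_Theta)
  with lambda_pi_least assms show ?thesis
    by blast
qed

lemma lambda_pi_lift:
  assumes "lambda_pi M N"
  shows "lambda_pi (lift M k) (lift N k)"
proof -
  let ?T = "\<lambda>M N. \<forall>k. lambda_pi (lift M k) (lift N k)"
  have "pi_theory ?T"
  proof (rule pi_theoryI)
    show "equivp ?T"
      by (intro equivpI reflpI sympI transpI)
        (simp, blast intro: lambda_pi_sym, blast intro: lambda_pi_trans)
    show "?T (Lam s \<degree> t) (subst s t 0)" for s t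
      using lambda_pi_beta by (simp add: lift_subst)
    show "?T (Lam (lift s 0 \<degree> Var 0)) s" for s
      using lambda_pi_eta by (simp add: lift_lift)
  qed (auto intro: lambda_pi_App lambda_pi_Lam lambda_pi_Theta)
  with lambda_pi_least assms show ?thesis
    by blast
qed

section \<open>The reducts of \<open>Theta\<close> and the consistency of
  \<open>lambda_pi\<close>\<close>

text \<open>Each of the three terms has its root as only beta-redex, and contracting it gives the
  next one cyclically.\<close>

lemma G_beta_Theta:
  "G_beta Theta = {B_term \<degree> C_term, C_term \<degree> Lam (Var 0 \<degree> C_term), Lam (Var 0 \<degree> C_term) \<degree> B_term}"
  (is "_ = {?a, ?b, ?c}")
proof -
  have beta_Var: "\<not> beta (Var i) t" for i t
    unfolding beta_def by (subst ctxt_closure.simps) (simp add: beta_rule.simps)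
  have beta_App: "beta (s \<degree> t) u \<longleftrightarrow> (\<exists>a. s = Lam a \<and> u = subst a t 0) \<or>
      (\<exists>s'. beta s s' \<and> u = s' \<degree> t) \<or> (\<exists>t'. beta t t' \<and> u = s \<degree> t')" for s t u
    unfolding beta_def by (subst ctxt_closure.simps) (auto simp: beta_rule.simps)
  have beta_Lam: "beta (Lam s) u \<longleftrightarrow> (\<exists>s'. beta s s' \<and> u = Lam s')" for s u
    unfolding beta_def by (subst ctxt_closure.simps) (auto simp: beta_rule.simps)
  note iff = B_term_def C_term_def beta_Var beta_App beta_Lam
  have cycle: "beta ?a t \<longleftrightarrow> t = ?b" "beta ?b t \<longleftrightarrow> t = ?c" "beta ?c t \<longleftrightarrow> t = ?a" for t
    by (auto simp: iff)
  have "t \<in> {?a, ?b, ?c}" if "beta\<^sup>*\<^sup>* ?a t" for t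
    using that by induct (auto simp: cycle)
  moreover have "beta ?a ?b" "beta ?b ?c"
    by (simp_all only: cycle)
  then have "beta\<^sup>*\<^sup>* ?a ?b" "beta\<^sup>*\<^sup>* ?a ?c"
    by (blast intro: rtranclp.intros)+
  ultimately show ?thesis
    unfolding G_beta_def Theta_def by blast
qed

lemma lift_G_beta_Theta: "s \<in> G_beta Theta \<Longrightarrow> lift s k = s"
  and subst_G_beta_Theta: "s \<in> G_beta Theta \<Longrightarrow> subst s u k = s"
  by (auto simp: G_beta_Theta B_term_def C_term_def)

lemma unlift_G_beta_Theta: "lift s k \<in> G_beta Theta \<Longrightarrow> lift s k = s"
  by (metis subst_G_beta_Theta subst_lift)

text \<open>These shapes exclude overlaps: an element is no operator of a beta-redex, no body of an
  eta-redex, and no element applied to two arguments.\<close>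

lemma G_beta_Theta_shape:
  "Var i \<notin> G_beta Theta" "Lam s \<notin> G_beta Theta" "s \<degree> Var i \<notin> G_beta Theta"
  "s \<degree> t \<degree> u \<notin> G_beta Theta" "Omega \<notin> G_beta Theta"
  by (auto simp: G_beta_Theta B_term_def C_term_def Omega_def)

text \<open>Closure under application covers \<open>Theta \<degree> Var i \<degree> Var i\<close>
  and \<open>Omega \<degree> t\<close>, closure under abstraction covers \<open>Lam Omega\<close>,
  as \<open>Omega_rule\<close> demands.\<close>

inductive_set hereditary_omega :: "lam set" where
  Theta: "s \<in> G_beta Theta \<Longrightarrow> s \<in> hereditary_omega"
| Omega: "Omega \<in> hereditary_omega"
| App: "s \<in> hereditary_omega \<Longrightarrow> s \<degree> t \<in> hereditary_omega"
| Lam: "s \<in> hereditary_omega \<Longrightarrow> Lam s \<in> hereditary_omega"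

lemma hereditary_omega_iff:
  "Var i \<notin> hereditary_omega"
  "Lam s \<in> hereditary_omega \<longleftrightarrow> s \<in> hereditary_omega"
  "s \<degree> t \<in> hereditary_omega \<longleftrightarrow> s \<in> hereditary_omega \<or> s \<degree> t \<in> G_beta Theta \<or> s \<degree> t = Omega"
  by (subst hereditary_omega.simps; auto simp: G_beta_Theta_shape Omega_def)+

lemma unlift_Omega: "lift s k = Omega \<Longrightarrow> s = Omega"
  by (metis lift_Omega lift_inject)

lemma unlift_hereditary_omega: "lift s k \<in> hereditary_omega \<Longrightarrow> s \<in> hereditary_omega"
proof (induct s arbitrary: k)
  case (App s t)
  from App.prems consider "lift s k \<in> hereditary_omega" | "lift (s \<degree> t) k \<in> G_beta Theta"
    | "lift (s \<degree> t) k = Omega"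
    by (auto simp: hereditary_omega_iff)
  then show ?case
  proof cases
    case 1
    then show ?thesis
      by (metis App.hyps(1) hereditary_omega.App)
  next
    case 2
    then show ?thesis
      by (metis hereditary_omega.Theta unlift_G_beta_Theta)
  next
    case 3
    then show ?thesis
      by (metis hereditary_omega.Omega unlift_Omega)
  qed
qed (auto simp: hereditary_omega_iff split: if_splits)

text \<open>Neither \<open>Omega\<close> nor an element of \<open>G_beta Theta\<close> has a
  variable as argument, so membership must come from the operator.\<close>

lemma eta_hereditary_omega: "lift s 0 \<degree> Var 0 \<in> hereditary_omega \<Longrightarrow> s \<in> hereditary_omega"
  by (auto simp: hereditary_omega_iff G_beta_Theta_shape Omega_def dest: unlift_hereditary_omega)

lemma subst_hereditary_omega: "s \<in> hereditary_omega \<Longrightarrow> subst s t k \<in> hereditary_omega"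
  by (induct arbitrary: t k rule: hereditary_omega.induct)
    (auto simp: subst_G_beta_Theta intro: hereditary_omega.intros)

lemma step_hereditary_omega:
  "s \<in> hereditary_omega \<Longrightarrow> step hereditary_omega s t \<Longrightarrow> t \<in> hereditary_omega"
proof (induct arbitrary: t rule: hereditary_omega.induct)
  case (Theta s)
  \<comment> \<open>\<open>B_term\<close> and \<open>C_term\<close> contain neither redexes nor
    elements of the set, so only the root can be contracted.\<close>
  then have "t = Omega \<or> t \<in> G_beta Theta"
    by (auto simp: G_beta_Theta B_term_def C_term_def Omega_def step_iff hereditary_omega_iff)
  then show ?case
    by (auto intro: hereditary_omega.intros)
next
  case Omega
  then have "t = Omega"
    by (auto simp: G_beta_Theta B_term_def C_term_def Omega_def step_iff hereditary_omega_iff)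
  then show ?case
    by (auto intro: hereditary_omega.intros)
next
  case (App s u)
  then show ?case
    by (auto simp: step_App_iff hereditary_omega_iff(2)
        intro: hereditary_omega.intros subst_hereditary_omega)
next
  case (Lam s)
  then show ?case
    by (auto simp: step_Lam_iff intro: hereditary_omega.intros dest: eta_hereditary_omega)
qed

interpretation hereditary_omega: Omega_rule hereditary_omega
proof
  show "lift s k \<in> hereditary_omega" if "s \<in> hereditary_omega" for s k
    using that by (induct arbitrary: k rule: hereditary_omega.induct)
      (auto simp: lift_G_beta_Theta intro: hereditary_omega.intros)
qed (fact unlift_hereditary_omega subst_hereditary_omega step_hereditary_omega eta_hereditary_omega
    | simp add: hereditary_omega_iff(1,2) hereditary_omega.intros)+

lemma Theta_in_G_beta: "Theta \<in> G_beta Theta"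
  by (simp add: G_beta_def)

lemma lambda_pi_consistent: "\<not> lambda_pi (Var 0) (Var 1)"
proof
  assume "lambda_pi (Var 0) (Var 1)"
  moreover have "pi_theory (equivclp (step hereditary_omega))"
    by (rule pi_theory_equivclp_step) (intro hereditary_omega.intros Theta_in_G_beta)
  ultimately have "equivclp (step hereditary_omega) (Var 0) (Var 1)"
    by (metis lambda_pi_def)
  then obtain u where u: "(step hereditary_omega)\<^sup>*\<^sup>* (Var 0) u"
      "(step hereditary_omega)\<^sup>*\<^sup>* (Var 1) u"
    by (rule confluentp_equivclpE [OF hereditary_omega.confluentp_step])
  have "u = Var i" if "(step hereditary_omega)\<^sup>*\<^sup>* (Var i) u" for i
    using that by (cases rule: converse_rtranclpE) (auto simp: step_Var_iff hereditary_omega_iff(1))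
  from this [OF u(1)] this [OF u(2)] show False
    by simp
qed

text \<open>Otherwise substituting for index 0 would equate \<open>M\<close> with every variable.
  This excludes the dangerous overlap of eta and pi.\<close>

lemma lambda_pi_lift_neq_Var: "\<not> lambda_pi (lift M 0) (Var 0)"
proof
  assume *: "lambda_pi (lift M 0) (Var 0)"
  have "lambda_pi M (Var i)" for i
    using lambda_pi_subst [OF *, of "Var i" 0] by simp
  then show False
    using lambda_pi_consistent lambda_pi_sym lambda_pi_trans by blast
qed

section \<open>Soundness and confluence of \<open>beta_eta_pi\<close>\<close>

lemma pi_rule_lambda_pi:
  assumes "pi_rule s t"
  shows "lambda_pi s t"
  using assms
proof cases
  case (1 \<Psi> M N)
  then have "equivclp beta Theta \<Psi>"
    by (simp add: G_beta_def rtranclp_into_equivclp)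
  then have "lambda_pi Theta \<Psi>"
    using equivclp_beta_lambda_pi by blast
  with 1 have "lambda_pi (\<Psi> \<degree> M \<degree> N) (Theta \<degree> M \<degree> M)"
    by (blast intro: lambda_pi_App lambda_pi_sym lambda_pi_refl)
  with 1 show ?thesis
    using lambda_pi_Theta lambda_pi_trans by blast
qed

lemma beta_eta_pi_lambda_pi:
  assumes "beta_eta_pi s t"
  shows "lambda_pi s t"
  using assms unfolding beta_eta_pi_def
  by (induct rule: ctxt_closure.induct)
    (auto simp: beta_rule.simps eta_rule.simps
      intro: lambda_pi_beta lambda_pi_eta pi_rule_lambda_pi lambda_pi_App lambda_pi_Lam)

text \<open>
  Adding \<^const>\<open>Omega\<close> does not change the reduction, as \<^const>\<open>Omega\<close> is its own \<open>\<beta>\<close>-reduct.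
\<close>

definition pi_redexes :: "lam set" where
  "pi_redexes = {\<Psi> \<degree> M \<degree> N | \<Psi> M N. \<Psi> \<in> G_beta Theta \<and> lambda_pi M N} \<union> {Omega}"

lemma step_pi_redexes: "step pi_redexes = beta_eta_pi"
proof -
  have "beta_rule Omega Omega"
    using beta_rule.intros [of "Var 0 \<degree> Var 0" "Lam (Var 0 \<degree> Var 0)"] by (simp add: Omega_def)
  then have "sup beta_rule (sup eta_rule (\<lambda>s t. s \<in> pi_redexes \<and> t = Omega))
      = sup beta_rule (sup eta_rule pi_rule)"
    by (intro ext) (auto simp: pi_redexes_def pi_rule.simps)
  then show ?thesis
    by (simp add: step_def beta_eta_pi_def)
qed

lemma pi_redexes_iff:
  "Var i \<notin> pi_redexes" "Lam s \<notin> pi_redexes"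
  "s \<degree> t \<in> pi_redexes \<longleftrightarrow>
     (\<exists>\<Psi> M. \<Psi> \<in> G_beta Theta \<and> s = \<Psi> \<degree> M \<and> lambda_pi M t) \<or> s \<degree> t = Omega"
  by (auto simp: pi_redexes_def Omega_def)

lemma beta_eta_pi_G_beta_Theta:
  assumes "\<Psi> \<in> G_beta Theta" "beta_eta_pi \<Psi> t"
  shows "t \<in> G_beta Theta"
  using assms
  by (auto simp: G_beta_Theta B_term_def C_term_def Omega_def step_iff pi_redexes_iff
      simp flip: step_pi_redexes)

lemma beta_eta_pi_Omega: "beta_eta_pi Omega t \<Longrightarrow> t = Omega"
  by (auto simp: Omega_def step_iff pi_redexes_iff simp flip: step_pi_redexes)

text \<open>Until the root is contracted, reduction acts only inside the three components and
  preserves their classes.\<close>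

lemma beta_eta_pi_Theta_App:
  assumes "\<Psi> \<in> G_beta Theta" "beta_eta_pi (\<Psi> \<degree> M \<degree> N) t"
  obtains (args) \<Psi>' M' N' where "\<Psi>' \<in> G_beta Theta" "lambda_pi M M'" "lambda_pi N N'"
      "t = \<Psi>' \<degree> M' \<degree> N'"
    | (contract) "lambda_pi M N" "t = Omega"
proof -
  \<comment> \<open>These inequalities exclude a beta-redex or a contraction to \<open>Omega\<close>
    at \<open>\<Psi> \<degree> M\<close>, and leave pi-reduction as the only root step.\<close>
  have "\<Psi> \<noteq> Lam a" "\<Psi> \<degree> M \<noteq> Omega" "\<Psi> \<degree> M \<degree> N \<noteq> Omega" for a
    using assms(1) G_beta_Theta_shape by (auto simp: Omega_def)
  moreover have "\<Psi> \<noteq> \<Psi>' \<degree> a" if "\<Psi>' \<in> G_beta Theta" for \<Psi>' a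
    using assms(1) that by (auto simp: G_beta_Theta B_term_def C_term_def)
  ultimately consider s' where "beta_eta_pi \<Psi> s'" "t = s' \<degree> M \<degree> N"
    | M' where "beta_eta_pi M M'" "t = \<Psi> \<degree> M' \<degree> N"
    | N' where "beta_eta_pi N N'" "t = \<Psi> \<degree> M \<degree> N'"
    | "lambda_pi M N" "t = Omega"
    using assms(2) unfolding step_pi_redexes [symmetric] step_App_iff pi_redexes_iff by blast
  then show thesis
  proof cases
    case (1 s')
    then show thesis
      using args [of s' M N] assms(1) beta_eta_pi_G_beta_Theta by simp
  next
    case (2 M')
    then show thesis
      using args [of \<Psi> M' N] assms(1) beta_eta_pi_lambda_pi by simp
  next
    case (3 N')
    then show thesis
      using args [of \<Psi> M N'] assms(1) beta_eta_pi_lambda_pi by simp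
  qed (rule contract)
qed

interpretation pi_redexes: Omega_rule pi_redexes
proof
  show "lift s k \<in> pi_redexes" if "s \<in> pi_redexes" for s k
    using that by (auto simp: pi_redexes_def lift_G_beta_Theta intro: lambda_pi_lift)
  show "s \<in> pi_redexes" if "lift s k \<in> pi_redexes" for s k
  proof (cases "s = Omega")
    case False
    with that obtain \<Psi> M N where *: "\<Psi> \<in> G_beta Theta" "lambda_pi M N" "lift s k = \<Psi> \<degree> M \<degree> N"
      by (auto simp: pi_redexes_def dest: unlift_Omega)
    \<comment> \<open>Substituting any term, here \<open>Omega\<close>, for the absent index
      \<open>k\<close> undoes the lifting, and the closed \<open>\<Psi>\<close> is
      unaffected.\<close>
    have "s = subst (\<Psi> \<degree> M \<degree> N) Omega k"
      by (simp flip: *(3))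
    with * show ?thesis
      by (auto simp: pi_redexes_def subst_G_beta_Theta intro: lambda_pi_subst)
  qed (simp add: pi_redexes_def)
  show "subst s t k \<in> pi_redexes" if "s \<in> pi_redexes" for s t k
    using that by (auto simp: pi_redexes_def subst_G_beta_Theta intro: lambda_pi_subst)
  show "t \<in> pi_redexes" if "s \<in> pi_redexes" "step pi_redexes s t" for s t
  proof (cases "s = Omega")
    case True
    with that show ?thesis
      by (auto simp: step_pi_redexes dest: beta_eta_pi_Omega)
  next
    case False
    with that obtain \<Psi> M N where s: "\<Psi> \<in> G_beta Theta" "lambda_pi M N" "s = \<Psi> \<degree> M \<degree> N"
      by (auto simp: pi_redexes_def)
    with that have "beta_eta_pi (\<Psi> \<degree> M \<degree> N) t"
      by (simp add: step_pi_redexes)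
    with s(1) show ?thesis
    proof (cases rule: beta_eta_pi_Theta_App)
      case (args \<Psi>' M' N')
      with s have "lambda_pi M' N'"
        by (blast intro: lambda_pi_sym lambda_pi_trans)
      with args show ?thesis
        by (auto simp: pi_redexes_def)
    qed (simp add: pi_redexes_def)
  qed
  \<comment> \<open>Membership would make a term free of index 0 equal to \<open>Var 0\<close> in
    \<open>lambda_pi\<close>, so the eta conditions are vacuous.\<close>
  have eta: "lift s 0 \<degree> Var 0 \<notin> pi_redexes" for s
    by (auto simp: pi_redexes_iff lift_eq_App lambda_pi_lift_neq_Var Omega_def)
  show "s \<in> pi_redexes" "Lam Omega \<in> pi_redexes" if "lift s 0 \<degree> Var 0 \<in> pi_redexes" for s
    using that eta by simp_all
qed (simp_all add: pi_redexes_iff(1,2))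

lemma confluentp_beta_eta_pi: "confluentp beta_eta_pi"
  using pi_redexes.confluentp_step by (simp add: step_pi_redexes)

text \<open>\<open>Omega\<close> is not of the form \<open>\<Psi> \<degree> M \<degree> N\<close>,
  so the root must be contracted at some point; until then the arguments stay equal in
  \<open>lambda_pi\<close> to the original ones.\<close>

lemma beta_eta_pi_steps_Omega:
  assumes "beta_eta_pi\<^sup>*\<^sup>* s Omega" "s = \<Psi> \<degree> M \<degree> N" "\<Psi> \<in> G_beta Theta"
  shows "lambda_pi M N"
  using assms
proof (induct arbitrary: \<Psi> M N rule: converse_rtranclp_induct)
  case base
  then show ?case
    by (simp add: Omega_def)
next
  case (step s t)
  from step.prems(2) step.hyps(1) [unfolded step.prems(1)] show ?case
  proof (cases rule: beta_eta_pi_Theta_App)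
    case (args \<Psi>' M' N')
    then have "lambda_pi M' N'"
      using step.hyps(3) by simp
    with args show ?thesis
      by (blast intro: lambda_pi_sym lambda_pi_trans)
  qed
qed

theorem theorem2p5:
  shows "confluentp beta_eta_pi \<and>
    (\<forall>M N. equivclp beta_eta_pi (Theta \<degree> M \<degree> N) Omega \<longleftrightarrow> lambda_pi M N)"
proof (intro conjI allI iffI)
  show "confluentp beta_eta_pi"
    by (rule confluentp_beta_eta_pi)
next
  fix M N
  assume "equivclp beta_eta_pi (Theta \<degree> M \<degree> N) Omega"
  then obtain u where u: "beta_eta_pi\<^sup>*\<^sup>* (Theta \<degree> M \<degree> N) u" "beta_eta_pi\<^sup>*\<^sup>* Omega u"
    by (rule confluentp_equivclpE [OF confluentp_beta_eta_pi])
  \<comment> \<open>\<open>Omega\<close> reduces only to itself, so the common reduct is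
    \<open>Omega\<close>.\<close>
  from u(2) have "u = Omega"
    by induct (auto dest: beta_eta_pi_Omega)
  with u(1) have "beta_eta_pi\<^sup>*\<^sup>* (Theta \<degree> M \<degree> N) Omega"
    by simp
  then show "lambda_pi M N"
    by (rule beta_eta_pi_steps_Omega [OF _ refl Theta_in_G_beta])
next
  fix M N
  assume "lambda_pi M N"
  then have "beta_eta_pi (Theta \<degree> M \<degree> N) Omega"
    unfolding beta_eta_pi_def
    by (intro ctxt_closure.base) (simp add: pi_rule.intros Theta_in_G_beta)
  then show "equivclp beta_eta_pi (Theta \<degree> M \<degree> N) Omega"
    by (rule r_into_equivclp)
qed

end
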